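(* Let $q=p^m$ with $p$ prime and $m>1$, and let $C$ be a linear $[n,k,d]$ code over $\mathbb{F}_q$. Let $C'$ be the associated $\mathbb{F}_q$-linear code of length $(q-1)n$ and $\mathrm{Tr}(C')$ its trace code over $\mathbb{F}_p$, as defined in the context. Then $\mathrm{Tr}(C')$ is a linear $[(q-1)n,\ mk,\ \frac{q(p-1)}{p}d]$ code over $\mathbb{F}_p$. Moreover, if $W(y)=\sum_{i=0}^n A_iy^i$ is the weight enumerator of $C$, then the weight enumerator of $\mathrm{Tr}(C')$ is $$W_T(y)=\sum_{i=0}^n A_i\,y^{q(p-1)i/p}.$$
   Context: Write $\mathbb{F}_q=\{0,\alpha_1=1,\alpha_2,\dots,\alpha_{q-1}\}$. A linear $[n,k,d]$ code over $\mathbb{F}_q$ is a $k$-dimensional subspace of $\mathbb{F}_q^n$ whose minimum weight (smallest Hamming weight of a nonzero codeword) is $d$. Its weight enumerator is $\sum_{i=0}^n A_i y^i$, where $A_i$ is the number of codewords of Hamming weight $i$. If $G$ is a generator matrix of $C$ (a $k\times n$ matrix whose rows form a basis of $C$), then $C'$ is the code over $\mathbb{F}_q$ generated by the matrix $G'=(G\,|\,\alpha_2G\,|\cdots|\,\alpha_{q-1}G)$, i.e. $C'=\{(c\,|\,\alpha_2c\,|\cdots|\,\alpha_{q-1}c): c\in C\}\subseteq\mathbb{F}_q^{(q-1)n}$. $\mathrm{Tr}:\mathbb{F}_q\to\mathbb{F}_p$ is the trace map, extended coordinatewise to vectors, and the trace code of a linear code $D$ over $\mathbb{F}_q$ is $\mathrm{Tr}(D)=\{\mathrm{Tr}(c):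 c\in D\}$, a linear code over $\mathbb{F}_p$. *)

theory Defs
  imports "Jordan_Normal_Form.VS_Connect" "HOL-Computational_Algebra.Primes"
    "HOL-Library.Cardinality"
begin

definition hamming_weight :: "'a::zero vec \<Rightarrow> nat" where
  "hamming_weight v = card {i. i < dim_vec v \<and> v $ i \<noteq> 0}"

definition is_min_weight :: "'a::zero vec set \<Rightarrow> nat \<Rightarrow> bool" where
  "is_min_weight C d \<longleftrightarrow>
     (\<exists>c\<in>C. c \<noteq> 0\<^sub>v (dim_vec c) \<and> hamming_weight c = d) \<and>
     (\<forall>c\<in>C. c \<noteq> 0\<^sub>v (dim_vec c) \<longrightarrow> d \<le> hamming_weight c)"

text \<open>
  The zero code has no minimum weight, so \<open>linear_code n k d C\<close> entails \<open>k > 0\<close>.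
\<close>

definition linear_code :: "nat \<Rightarrow> nat \<Rightarrow> nat \<Rightarrow> 'a::field vec set \<Rightarrow> bool" where
  "linear_code n k d C \<longleftrightarrow>
     VectorSpace.subspace class_ring C (module_vec TYPE('a) n) \<and>
     vectorspace.dim class_ring ((module_vec TYPE('a) n)\<lparr>carrier := C\<rparr>) = k \<and>
     is_min_weight C d"

definition weight_count :: "'a::zero vec set \<Rightarrow> nat \<Rightarrow> nat" where
  "weight_count C i = card {c \<in> C. hamming_weight c = i}"

definition weight_enumerator :: "nat \<Rightarrow> 'a::zero vec set \<Rightarrow> nat poly" where
  "weight_enumerator n C = (\<Sum>i\<le>n. monom (weight_count C i) i)"

text \<open>
  For \<open>\<alpha>s = [\<alpha>\<^sub>1, \<dots>, \<alpha>\<^sub>r]\<close>, \<open>scaled_copies \<alpha>s c\<close> is the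
  concatenation \<open>(\<alpha>\<^sub>1c | \<dots> | \<alpha>\<^sub>rc)\<close>.
\<close>

definition scaled_copies :: "'a::semiring_0 list \<Rightarrow> 'a vec \<Rightarrow> 'a vec" where
  "scaled_copies \<alpha>s c = foldr (\<lambda>\<alpha> v. (\<alpha> \<cdot>\<^sub>v c) @\<^sub>v v) \<alpha>s vNil"

definition scaled_code :: "'a::semiring_0 list \<Rightarrow> 'a vec set \<Rightarrow> 'a vec set" where
  "scaled_code \<alpha>s C = scaled_copies \<alpha>s ` C"

text \<open>
  The fields \<open>\<F>\<^sub>p\<close> and \<open>\<F>\<^sub>q\<close> are separate types, and the inclusion of the
  former into the latter is a field homomorphism \<open>\<iota>\<close>. The sum
  \<open>x + x\<^sup>p + \<dots>\<close> lies in the prime field, that is in the range of \<open>\<iota>\<close>,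
  and the trace is its preimage under \<open>\<iota>\<close>; see \<open>field_trace_eq\<close> below.
\<close>

definition field_trace :: "('b \<Rightarrow> 'a) \<Rightarrow> nat \<Rightarrow> nat \<Rightarrow> 'a::field \<Rightarrow> 'b::field" where
  "field_trace \<iota> p m x = inv_into UNIV \<iota> (\<Sum>i<m. x ^ (p ^ i))"

lemma field_trace_eq:
  fixes \<iota> :: "'b::finite_field \<Rightarrow> 'a::finite_field"
  assumes "prime p" and "CARD('a) = p ^ m" and "CARD('b) = p" and "field_hom \<iota>"
  shows "\<iota> (field_trace \<iota> p m x) = (\<Sum>i<m. x ^ (p ^ i))"
proof -
  interpret field_hom \<iota> by fact
  define s where "s = (\<Sum>i<m. x ^ (p ^ i))"
  define P :: "'a poly" where "P = monom 1 p - monom 1 1"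
  have p1: "p > 1" using assms(1) by (rule prime_gt_1_nat)
  have "of_nat p = (0::'b)"
  proof -
    have "(\<Sum>b\<in>(UNIV::'b set). b + 1) = (\<Sum>b\<in>UNIV. b)"
      by (rule sum.reindex_bij_witness[of _ "\<lambda>b. b - 1" "\<lambda>b. b + 1"]) auto
    then show ?thesis using assms(3) by (simp add: sum.distrib)
  qed
  then have "\<iota> (of_nat p) = 0" by simp
  then have "of_nat p = (0::'a)" by (simp add: hom_of_nat)
  then have "CHAR('a) dvd p" by (simp add: of_nat_eq_0_iff_char_dvd)
  then have ch: "CHAR('a) = p"
    using assms(1) by (metis CHAR_not_1' One_nat_def prime_nat_iff)
  have "s ^ p = (\<Sum>i<m. (x ^ (p ^ i)) ^ p)"
    unfolding s_def using freshmans_dream_sum[where 'a = 'a] ch assms(1) by metis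
  also have "\<dots> = (\<Sum>i<m. x ^ (p ^ Suc i))"
    by (simp add: power_mult[symmetric] mult.commute)
  also have "\<dots> = s - x + x ^ (p ^ m)"
    unfolding s_def by (induction m) simp_all
  also have "x ^ (p ^ m) = x"
    using finite_field_power_card_eq_same[of x] assms(2) by simp
  finally have s: "poly P s = 0" by (simp add: P_def poly_monom)
  have "coeff P p = 1" using p1 by (simp add: P_def)
  then have P0: "P \<noteq> 0" by auto
  have degP: "degree P \<le> p"
    unfolding P_def using p1 by (intro degree_diff_le) (auto simp: degree_monom_eq)
  have sub: "range \<iota> \<subseteq> {y. poly P y = 0}"
  proof clarify
    fix b :: 'b
    have "b ^ p = b" using finite_field_power_card_eq_same[of b] assms(3) by simp
    then have "\<iota> b ^ p = \<iota> b" by (simp flip: hom_power)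
    then show "poly P (\<iota> b) = 0" by (simp add: P_def poly_monom)
  qed
  have "card (range \<iota>) = p"
    using assms(3) by (simp add: card_image inj_f)
  then have "range \<iota> = {y. poly P y = 0}"
    using card_poly_roots_bound[OF P0] degP by (intro card_seteq sub poly_roots_finite P0) auto
  with s have "s \<in> range \<iota>" by auto
  then show ?thesis unfolding field_trace_def s_def by (rule f_inv_into_f)
qed

definition trace_code ::
    "('b \<Rightarrow> 'a) \<Rightarrow> nat \<Rightarrow> nat \<Rightarrow> 'a::field vec set \<Rightarrow> 'b::field vec set" where
  "trace_code \<iota> p m D = map_vec (field_trace \<iota> p m) ` D"

end

theory Submission
  imports Defs
begin

text \<open>
  The map \<open>T c = Tr (\<alpha>\<^sub>1c | \<dots> | \<alpha>\<^sub>rc)\<close> is linear over \<open>\<F>\<^sub>p\<close>. For a fixed coordinate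
  \<open>c\<^sub>i \<noteq> 0\<close>, the products \<open>\<alpha>\<^sub>jc\<^sub>i\<close> run through all nonzero elements of \<open>\<F>\<^sub>q\<close>, of which exactly
  \<open>q - q/p\<close> have nonzero trace. Hence \<open>T\<close> multiplies all weights by \<open>q(p - 1)/p\<close>, which makes it
  injective and transports the weight enumerator; the dimension is found by counting codewords.
\<close>

section \<open>Cardinality and dimension of finite vector spaces\<close>

lemma (in vectorspace) card_carrier_eq_card_power_dim:
  assumes fin: "finite (carrier V)"
  shows "card (carrier V) = card (carrier K) ^ dim"
proof -
  \<comment> \<open>A finite carrier is itself a finite generating set, which gives finite dimension
    and hence a finite basis.\<close>
  have "carrier V \<subseteq> span (carrier V)"
    by (rule in_own_span) simp
  moreover have "span (carrier V) \<subseteq> carrier V"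
    using span_is_subset2[of "carrier V"] by simp
  ultimately have "fin_dim"
    unfolding fin_dim_def using fin by auto
  then obtain A where A: "finite A" "basis A"
    using finite_basis_exists by blast
  then have AV: "A \<subseteq> carrier V"
    by (simp add: basis_def)
  \<comment> \<open>Each vector has unique coordinates with respect to \<open>A\<close>. Taking
    coordinate functions that are undefined outside \<open>A\<close> makes them unique as functions,
    so that they can be counted.\<close>
  have "bij_betw (\<lambda>a. lincomb a A) (A \<rightarrow>\<^sub>E carrier K) (carrier V)"
    unfolding bij_betw_def
  proof (intro conjI inj_onI)
    have uniq: "\<exists>!a. a \<in> A \<rightarrow>\<^sub>E carrier K \<and> lincomb a A = v" if "v \<in> carrier V" for v
      using basis_criterion[OF A(1) AV] A(2) that by blast
    have closed: "lincomb a A \<in> carrier V" if "a \<in> A \<rightarrow>\<^sub>E carrier K" for a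
      using that AV by (intro lincomb_closed) auto
    show "a = b" if "a \<in> A \<rightarrow>\<^sub>E carrier K" "b \<in> A \<rightarrow>\<^sub>E carrier K" "lincomb a A = lincomb b A" for a b
      using uniq[OF closed[OF that(1)]] that by metis
    show "(\<lambda>a. lincomb a A) ` (A \<rightarrow>\<^sub>E carrier K) = carrier V"
      using uniq closed by blast
  qed
  then have "card (carrier V) = card (A \<rightarrow>\<^sub>E carrier K)"
    by (simp add: bij_betw_same_card)
  also have "\<dots> = card (carrier K) ^ dim"
    using A by (simp add: card_PiE dim_basis)
  finally show ?thesis .
qed

text \<open>Replaces the module-theoretic notion of subspace by elementary closure conditions: one
  direction unpacks the hypothesis on \<open>C\<close>, the other establishes linearity of the trace
  code.\<close>

lemma subspace_class_ring_iff:
  fixes C :: "'a::field vec set"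
  shows "VectorSpace.subspace class_ring C (module_vec TYPE('a) n) \<longleftrightarrow>
    C \<subseteq> carrier_vec n \<and> 0\<^sub>v n \<in> C \<and> (\<forall>v\<in>C. \<forall>w\<in>C. v + w \<in> C) \<and> (\<forall>a. \<forall>v\<in>C. a \<cdot>\<^sub>v v \<in> C)"
  using vec_vs[of n, where 'a = 'a] vec_module[of n, where 'a = 'a]
  by (auto simp: subspace_def submodule_def module_vec_simps)

text \<open>Lets a dimension be read off from the number of codewords, so no basis of the trace code
  has to be exhibited.\<close>

lemma card_subspace_eq_card_power_dim:
  fixes C :: "'a::{field,finite} vec set"
  assumes "VectorSpace.subspace class_ring C (module_vec TYPE('a) n)"
  shows "finite C"
    and "card C =
      CARD('a) ^ vectorspace.dim class_ring ((module_vec TYPE('a) n)\<lparr>carrier := C\<rparr>)"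
proof -
  interpret V: vectorspace class_ring "module_vec TYPE('a) n"
    by (rule vec_vs)
  interpret W: vectorspace class_ring "(module_vec TYPE('a) n)\<lparr>carrier := C\<rparr>"
    by (rule V.subspace_is_vs[OF assms])
  have "finite (carrier_vec n :: 'a vec set)"
  proof (rule finite_surj)
    show "finite {xs :: 'a list. set xs \<subseteq> UNIV \<and> length xs = n}"
      by (rule finite_lists_length_eq) simp
    show "carrier_vec n \<subseteq> vec_of_list ` {xs :: 'a list. set xs \<subseteq> UNIV \<and> length xs = n}"
      by (auto intro!: image_eqI[where x = "list_of_vec v" for v] simp: vec_list)
  qed
  moreover have "C \<subseteq> carrier_vec n"
    using assms by (simp add: subspace_class_ring_iff)
  ultimately show fin: "finite C"
    using finite_subset by blast
  then show "card C =
      CARD('a) ^ vectorspace.dim class_ring ((module_vec TYPE('a) n)\<lparr>carrier := C\<rparr>)"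
    using W.card_carrier_eq_card_power_dim by simp
qed

section \<open>Hamming weights and weight enumerators\<close>

lemma hamming_weight_le_dim: "hamming_weight v \<le> dim_vec v"
  unfolding hamming_weight_def
  by (rule order.trans[OF card_mono[of "{..<dim_vec v}"]]) auto

lemma hamming_weight_eq_0_iff: "hamming_weight v = 0 \<longleftrightarrow> v = 0\<^sub>v (dim_vec v)"
  by (auto simp: hamming_weight_def vec_eq_iff)

lemma hamming_weight_append:
  "hamming_weight (v @\<^sub>v w) = hamming_weight v + hamming_weight w"
proof -
  let ?S = "\<lambda>u. {i. i < dim_vec u \<and> u $ i \<noteq> 0}"
  have "?S (v @\<^sub>v w) = ?S v \<union> (\<lambda>i. i + dim_vec v) ` ?S w"
  proof (intro equalityI subsetI)
    fix i assume i: "i \<in> ?S (v @\<^sub>v w)"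
    show "i \<in> ?S v \<union> (\<lambda>i. i + dim_vec v) ` ?S w"
    proof (cases "i < dim_vec v")
      case False
      then have "i - dim_vec v \<in> ?S w" "i = (i - dim_vec v) + dim_vec v"
        using i by auto
      then show ?thesis by blast
    qed (use i in auto)
  qed auto
  moreover have "?S v \<inter> (\<lambda>i. i + dim_vec v) ` ?S w = {}"
    by auto
  ultimately show ?thesis
    by (simp add: hamming_weight_def card_Un_disjoint card_image)
qed

text \<open>Codewords are grouped by weight. The free exponent \<open>f\<close> serves two uses: the
  identity for the enumerator of the trace code, and multiplication by a constant for the right-hand
  side of the theorem.\<close>

lemma sum_monom_weight_count:
  fixes f :: "nat \<Rightarrow> nat"
  assumes "finite C" "\<And>c. c \<in> C \<Longrightarrow> hamming_weight c \<le> n"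
  shows "(\<Sum>i\<le>n. monom (weight_count C i) (f i)) = (\<Sum>c\<in>C. monom 1 (f (hamming_weight c)))"
proof -
  have "(\<Sum>c\<in>C. monom (1::nat) (f (hamming_weight c))) =
      (\<Sum>i\<le>n. \<Sum>c\<in>{c \<in> C. hamming_weight c = i}. monom 1 (f (hamming_weight c)))"
    using assms by (intro sum.group[symmetric]) auto
  also have "\<dots> = (\<Sum>i\<le>n. monom (weight_count C i) (f i))"
  proof (intro sum.cong refl)
    fix i
    have "(\<Sum>c\<in>{c \<in> C. hamming_weight c = i}. monom (1::nat) (f (hamming_weight c))) =
        (\<Sum>c\<in>{c \<in> C. hamming_weight c = i}. monom 1 (f i))"
      by (intro sum.cong) auto
    then show "(\<Sum>c\<in>{c \<in> C. hamming_weight c = i}. monom (1::nat) (f (hamming_weight c))) =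
        monom (weight_count C i) (f i)"
      by (simp add: weight_count_def of_nat_monom mult_monom)
  qed
  finally show ?thesis ..
qed

section \<open>Concatenations of scalar multiples\<close>

lemma scaled_copies_Nil [simp]: "scaled_copies [] c = vNil"
  and scaled_copies_Cons [simp]:
    "scaled_copies (\<alpha> # \<alpha>s) c = (\<alpha> \<cdot>\<^sub>v c) @\<^sub>v scaled_copies \<alpha>s c"
  by (simp_all add: scaled_copies_def)

lemma dim_scaled_copies [simp]: "dim_vec (scaled_copies \<alpha>s c) = length \<alpha>s * dim_vec c"
  by (induction \<alpha>s) simp_all

lemma map_vec_append: "map_vec f (v @\<^sub>v w) = map_vec f v @\<^sub>v map_vec f w"
  by (intro eq_vecI) auto

lemma smult_append_vec: "a \<cdot>\<^sub>v (v @\<^sub>v w) = a \<cdot>\<^sub>v v @\<^sub>v a \<cdot>\<^sub>v w"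
  by (intro eq_vecI) auto

lemma scaled_copies_zero: "scaled_copies \<alpha>s (0\<^sub>v n) = 0\<^sub>v (length \<alpha>s * n)"
proof (induction \<alpha>s)
  case (Cons \<alpha> \<alpha>s)
  then show ?case
    by (intro eq_vecI) auto
qed auto

lemma scaled_copies_add:
  assumes "dim_vec c = dim_vec c'"
  shows "scaled_copies \<alpha>s (c + c') = scaled_copies \<alpha>s c + scaled_copies \<alpha>s c'"
proof (induction \<alpha>s)
  case (Cons \<alpha> \<alpha>s)
  have "\<alpha> \<cdot>\<^sub>v (c + c') = \<alpha> \<cdot>\<^sub>v c + \<alpha> \<cdot>\<^sub>v c'"
    using assms by (intro eq_vecI) (auto simp: distrib_left)
  moreover have "(\<alpha> \<cdot>\<^sub>v c @\<^sub>v scaled_copies \<alpha>s c) + (\<alpha> \<cdot>\<^sub>v c' @\<^sub>v scaled_copies \<alpha>s c') =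
      (\<alpha> \<cdot>\<^sub>v c + \<alpha> \<cdot>\<^sub>v c') @\<^sub>v (scaled_copies \<alpha>s c + scaled_copies \<alpha>s c')"
    using assms
    by (intro append_vec_add[of _ "dim_vec c" _ _ "length \<alpha>s * dim_vec c"] carrier_vecI) simp_all
  ultimately show ?case
    using Cons by simp
qed auto

lemma scaled_copies_smult:
  fixes c :: "'a::comm_semiring_0 vec"
  shows "scaled_copies \<alpha>s (a \<cdot>\<^sub>v c) = a \<cdot>\<^sub>v scaled_copies \<alpha>s c"
proof (induction \<alpha>s)
  case (Cons \<alpha> \<alpha>s)
  have "\<alpha> \<cdot>\<^sub>v (a \<cdot>\<^sub>v c) = a \<cdot>\<^sub>v (\<alpha> \<cdot>\<^sub>v c)"
    by (intro eq_vecI) (auto simp: mult.left_commute)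
  then show ?case
    using Cons by (simp add: smult_append_vec)
qed auto

text \<open>Double counting: nonzero entries are collected by coordinate of \<open>c\<close> rather
  than by block. Distinctness turns the count of blocks into the cardinality of a set of
  scalars.\<close>

lemma hamming_weight_map_scaled_copies:
  assumes "distinct \<alpha>s"
  shows "hamming_weight (map_vec f (scaled_copies \<alpha>s c)) =
    (\<Sum>i<dim_vec c. card {\<alpha> \<in> set \<alpha>s. f (\<alpha> * c $ i) \<noteq> 0})"
  using assms
proof (induction \<alpha>s)
  case (Cons \<alpha> \<alpha>s)
  have "hamming_weight (map_vec f (\<alpha> \<cdot>\<^sub>v c)) =
      (\<Sum>i<dim_vec c. if f (\<alpha> * c $ i) \<noteq> 0 then 1 else 0)"
    by (auto simp: hamming_weight_def sum.If_cases intro!: arg_cong[of _ _ card])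
  moreover have "card {\<beta> \<in> set (\<alpha> # \<alpha>s). f (\<beta> * x) \<noteq> 0} =
      (if f (\<alpha> * x) \<noteq> 0 then 1 else 0) + card {\<beta> \<in> set \<alpha>s. f (\<beta> * x) \<noteq> 0}" for x
  proof -
    have "{\<beta> \<in> set (\<alpha> # \<alpha>s). f (\<beta> * x) \<noteq> 0} =
        (if f (\<alpha> * x) \<noteq> 0 then {\<alpha>} else {}) \<union> {\<beta> \<in> set \<alpha>s. f (\<beta> * x) \<noteq> 0}"
      by auto
    then show ?thesis
      using Cons.prems by simp
  qed
  ultimately show ?case
    using Cons by (simp add: map_vec_append hamming_weight_append sum.distrib)
qed (simp add: hamming_weight_def)

section \<open>The trace of a finite field extension\<close>

lemma of_nat_CARD_eq_0: "of_nat CARD('a) = (0 :: 'a::{ring_1,finite})"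
proof -
  \<comment> \<open>Translation by 1 permutes the ring, so adding 1 to every summand leaves the sum
    of all elements unchanged.\<close>
  have "(\<Sum>a\<in>(UNIV :: 'a set). a + 1) = (\<Sum>a\<in>UNIV. a)"
    by (rule sum.reindex_bij_witness[of _ "\<lambda>a. a - 1" "\<lambda>a. a + 1"]) auto
  then show ?thesis
    by (simp add: sum.distrib)
qed

locale finite_field_trace = field_hom \<iota>
  for \<iota> :: "'b::finite_field \<Rightarrow> 'a::finite_field" +
  fixes p m :: nat
  assumes prime_p: "prime p"
    and card_ext: "CARD('a) = p ^ m"
    and card_base: "CARD('b) = p"
begin

abbreviation tr :: "'a \<Rightarrow> 'b" where
  "tr \<equiv> field_trace \<iota> p m"

lemma hom_tr: "\<iota> (tr x) = (\<Sum>i<m. x ^ (p ^ i))"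
  by (rule field_trace_eq[OF prime_p card_ext card_base field_hom_axioms])

lemma m_pos: "m > 0"
proof (rule ccontr)
  assume "\<not> m > 0"
  then have "card {0, 1 :: 'a} \<le> 1"
    using card_ext card_mono[of UNIV "{0, 1 :: 'a}"] by simp
  then show False by simp
qed

lemma card_ext_Suc: "CARD('a) = p * p ^ (m - 1)"
  using card_ext m_pos by (cases m) auto

text \<open>Needed for the freshman's dream. Since p vanishes in the base field, it vanishes in the
  extension through \<open>\<iota>\<close>, so the characteristic is a prime dividing the prime
  p.\<close>

lemma CHAR_ext: "CHAR('a) = p"
proof -
  have "prime CHAR('a)"
    by (intro prime_CHAR_semidom finite_imp_CHAR_pos) simp
  moreover have "CHAR('a) dvd p"
  proof -
    have "\<iota> (of_nat p) = 0"
      using of_nat_CARD_eq_0[where 'a = 'b] card_base by simp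
    then show ?thesis
      by (simp add: hom_of_nat of_nat_eq_0_iff_char_dvd)
  qed
  ultimately show ?thesis
    using prime_p primes_dvd_imp_eq by blast
qed

text \<open>Each power map with exponent \<open>p ^ i\<close> is additive in characteristic p;
  injectivity of \<open>\<iota>\<close> brings the identity back to the base field.\<close>

lemma tr_add: "tr (x + y) = tr x + tr y"
proof -
  have "\<iota> (tr (x + y)) = \<iota> (tr x + tr y)"
    using prime_p
    by (simp add: hom_tr hom_add sum.distrib freshmans_dream'[where 'a = 'a] CHAR_ext)
  then show ?thesis by simp
qed

lemma tr_zero [simp]: "tr 0 = 0"
  using tr_add[of 0 0] by (metis add_0 add_right_cancel)

lemma tr_diff: "tr (x - y) = tr x - tr y"
  using tr_add[of "x - y" y] by simp

text \<open>Elements of the base field are fixed by the Frobenius map, so \<open>\<iota> b\<close>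
  factors out of every summand of the trace.\<close>

lemma tr_smult: "tr (\<iota> b * x) = b * tr x"
proof -
  have "b ^ (p ^ i) = b" for i
  proof (induction i)
    case (Suc i)
    have "b ^ (p ^ Suc i) = (b ^ (p ^ i)) ^ p"
      by (simp add: power_mult[symmetric] mult.commute)
    then show ?case
      using Suc finite_field_power_card_eq_same[of b] card_base by simp
  qed simp
  then have "\<iota> (tr (\<iota> b * x)) = \<iota> (b * tr x)"
    by (simp add: hom_tr hom_mult power_mult_distrib sum_distrib_left flip: hom_power)
  then show ?thesis by simp
qed

text \<open>The kernel is the root set of a polynomial of degree at most \<open>p ^ (m - 1)\<close>,
  which bounds it above. Conversely, the p fibres of the trace cover the field and none is larger
  than the kernel, which bounds it below.\<close>

lemma card_ker_tr: "card {x. tr x = 0} = p ^ (m - 1)"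
proof (rule antisym)
  define P :: "'a poly" where "P = (\<Sum>i<m. monom 1 (p ^ i))"
  have p1: "p > 1"
    using prime_p by (rule prime_gt_1_nat)
  \<comment> \<open>Only i = 0 gives \<open>p ^ i = 1\<close>, so the linear coefficient is 1 and
    \<open>P\<close> is not the zero polynomial.\<close>
  have "coeff P 1 = (\<Sum>i<m. if i = 0 then 1 else 0)"
    unfolding P_def coeff_sum using p1 by (intro sum.cong) auto
  then have "P \<noteq> 0"
    using m_pos by auto
  moreover have "degree P \<le> p ^ (m - 1)"
    unfolding P_def using p1 by (intro degree_sum_le) (auto simp: degree_monom_eq)
  moreover have "{x. tr x = 0} = {x. poly P x = 0}"
  proof -
    have "tr x = 0 \<longleftrightarrow> \<iota> (tr x) = 0" for x by simp
    then show ?thesis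
      by (simp add: P_def poly_sum poly_monom hom_tr)
  qed
  ultimately show "card {x. tr x = 0} \<le> p ^ (m - 1)"
    using card_poly_roots_bound[of P] by simp
next
  \<comment> \<open>A nonempty fibre is translated into the kernel by subtracting one of its points;
    this way surjectivity of the trace need not be known.\<close>
  have "card {x. tr x = b} \<le> card {x. tr x = 0}" for b
  proof (cases "\<exists>y. tr y = b")
    case True
    then obtain y where y: "tr y = b" ..
    have "(\<lambda>x. x - y) ` {x. tr x = b} \<subseteq> {x. tr x = 0}"
      by (auto simp: tr_diff y)
    then show ?thesis
      by (intro card_inj_on_le[of "\<lambda>x. x - y"]) (auto intro: inj_onI)
  qed simp
  then have "(\<Sum>b\<in>UNIV. card {x. tr x = b}) \<le> p * card {x. tr x = 0}"
    using sum_bounded_above[of UNIV "\<lambda>b. card {x. tr x = b}"] card_base by simp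
  also have "(\<Sum>b\<in>UNIV. card {x. tr x = b}) = CARD('a)"
    using sum.group[of "UNIV :: 'a set" UNIV tr "\<lambda>_. 1 :: nat"] by simp
  also have "\<dots> = p * p ^ (m - 1)"
    by (rule card_ext_Suc)
  finally show "p ^ (m - 1) \<le> card {x. tr x = 0}"
    using prime_gt_0_nat[OF prime_p] by simp
qed

text \<open>Multiplication by a nonzero \<open>x\<close> permutes the field, so this counts the
  complement of the kernel of the trace; 0 lies in that kernel.\<close>

lemma card_tr_mult_nonzero:
  assumes "x \<noteq> 0"
  shows "card {\<alpha> \<in> UNIV - {0}. tr (\<alpha> * x) \<noteq> 0} = p ^ (m - 1) * (p - 1)"
proof -
  have "card {\<alpha> \<in> UNIV - {0}. tr (\<alpha> * x) \<noteq> 0} = card {y. tr y \<noteq> 0}"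
  proof (rule bij_betw_same_card)
    show "bij_betw (\<lambda>\<alpha>. \<alpha> * x) {\<alpha> \<in> UNIV - {0}. tr (\<alpha> * x) \<noteq> 0} {y. tr y \<noteq> 0}"
      using assms by (intro bij_betwI[of _ _ _ "\<lambda>y. y / x"]) auto
  qed
  also have "\<dots> = CARD('a) - card {y. tr y = 0}"
    by (subst card_Diff_subset[symmetric]) (auto intro!: arg_cong[of _ _ card])
  also have "\<dots> = p ^ (m - 1) * (p - 1)"
    by (simp add: card_ker_tr card_ext_Suc algebra_simps)
  finally show ?thesis .
qed

section \<open>The map from codewords to trace codewords\<close>

lemma map_tr_add:
  "dim_vec v = dim_vec w \<Longrightarrow> map_vec tr (v + w) = map_vec tr v + map_vec tr w"
  by (auto simp: vec_eq_iff tr_add)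

lemma map_tr_smult: "map_vec tr (\<iota> b \<cdot>\<^sub>v v) = b \<cdot>\<^sub>v map_vec tr v"
  by (auto simp: vec_eq_iff tr_smult)

lemma hamming_weight_tr_scaled_copies:
  assumes "distinct \<alpha>s" "set \<alpha>s = UNIV - {0}"
  shows "hamming_weight (map_vec tr (scaled_copies \<alpha>s c)) =
    p ^ (m - 1) * (p - 1) * hamming_weight c"
proof -
  have "hamming_weight (map_vec tr (scaled_copies \<alpha>s c)) =
      (\<Sum>i<dim_vec c. if c $ i \<noteq> 0 then p ^ (m - 1) * (p - 1) else 0)"
    unfolding hamming_weight_map_scaled_copies[OF assms(1)] assms(2)
    using card_tr_mult_nonzero by (intro sum.cong) auto
  also have "{..<dim_vec c} \<inter> {i. c $ i \<noteq> 0} = {i. i < dim_vec c \<and> c $ i \<noteq> 0}"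
    by auto
  then have "(\<Sum>i<dim_vec c. if c $ i \<noteq> 0 then p ^ (m - 1) * (p - 1) else 0) =
      p ^ (m - 1) * (p - 1) * hamming_weight c"
    by (simp add: sum.If_cases hamming_weight_def)
  finally show ?thesis .
qed

text \<open>The map is additive and multiplies weights by a positive constant, so a difference sent
  to zero has weight zero.\<close>

lemma inj_on_tr_scaled_copies:
  assumes "distinct \<alpha>s" "set \<alpha>s = UNIV - {0}"
  shows "inj_on (\<lambda>c. map_vec tr (scaled_copies \<alpha>s c)) (carrier_vec n)"
proof (rule inj_onI)
  fix c c' :: "'a vec"
  assume c: "c \<in> carrier_vec n" "c' \<in> carrier_vec n"
    and eq: "map_vec tr (scaled_copies \<alpha>s c) = map_vec tr (scaled_copies \<alpha>s c')"
  \<comment> \<open>Writing \<open>c\<close> as \<open>(c - c') + c'\<close> reduces the claim about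
    differences to additivity.\<close>
  have "map_vec tr (scaled_copies \<alpha>s (c - c')) + map_vec tr (scaled_copies \<alpha>s c') =
      map_vec tr (scaled_copies \<alpha>s (c - c' + c'))"
    using c by (simp add: scaled_copies_add map_tr_add)
  also have "c - c' + c' = c"
    using c by (auto simp: vec_eq_iff)
  finally have "map_vec tr (scaled_copies \<alpha>s (c - c')) + map_vec tr (scaled_copies \<alpha>s c') =
      map_vec tr (scaled_copies \<alpha>s c')"
    using eq by simp
  then have "map_vec tr (scaled_copies \<alpha>s (c - c')) = 0\<^sub>v (length \<alpha>s * n)"
    using c by (auto simp: vec_eq_iff)
  then have "hamming_weight (map_vec tr (scaled_copies \<alpha>s (c - c'))) = 0"
    by (simp add: hamming_weight_eq_0_iff)
  then have "hamming_weight (c - c') = 0"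
    using hamming_weight_tr_scaled_copies[OF assms] prime_gt_1_nat[OF prime_p] by simp
  then show "c = c'"
    using c by (auto simp: hamming_weight_eq_0_iff vec_eq_iff)
qed

lemma subspace_trace_code:
  assumes "VectorSpace.subspace class_ring C (module_vec TYPE('a) n)"
  shows "VectorSpace.subspace class_ring (trace_code \<iota> p m (scaled_code \<alpha>s C))
    (module_vec TYPE('b) (length \<alpha>s * n))"
proof -
  let ?T = "\<lambda>c. map_vec tr (scaled_copies \<alpha>s c)"
  have C: "C \<subseteq> carrier_vec n" "0\<^sub>v n \<in> C"
      "\<And>v w. v \<in> C \<Longrightarrow> w \<in> C \<Longrightarrow> v + w \<in> C" "\<And>a v. v \<in> C \<Longrightarrow> a \<cdot>\<^sub>v v \<in> C"
    using assms by (auto simp: subspace_class_ring_iff)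
  have zero: "?T (0\<^sub>v n) = 0\<^sub>v (length \<alpha>s * n)"
    by (auto simp: scaled_copies_zero vec_eq_iff)
  have add: "?T v + ?T w = ?T (v + w)" if "v \<in> C" "w \<in> C" for v w
  proof -
    have "dim_vec v = dim_vec w"
      using that C(1) by (metis carrier_vecD subsetD)
    then show ?thesis
      by (simp add: scaled_copies_add map_tr_add)
  qed
  \<comment> \<open>A scalar of the base field acts on the image as \<open>\<iota> b\<close> acts on
    \<open>C\<close>, which is closed under all scalars of the extension.\<close>
  have smult: "b \<cdot>\<^sub>v ?T v = ?T (\<iota> b \<cdot>\<^sub>v v)" for b v
    by (simp add: scaled_copies_smult map_tr_smult)
  have "?T ` C \<subseteq> carrier_vec (length \<alpha>s * n)"
    using C(1) by (auto intro!: carrier_vecI)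
  moreover have "0\<^sub>v (length \<alpha>s * n) \<in> ?T ` C"
    using zero C(2) by (metis imageI)
  moreover have "\<forall>x\<in>?T ` C. \<forall>y\<in>?T ` C. x + y \<in> ?T ` C"
    using add C(3) by auto
  moreover have "\<forall>b. \<forall>x\<in>?T ` C. b \<cdot>\<^sub>v x \<in> ?T ` C"
    using smult C(4) by auto
  ultimately show ?thesis
    by (simp add: subspace_class_ring_iff trace_code_def scaled_code_def image_image)
qed

end

section \<open>Parameters and weight enumerator of the trace code\<close>

theorem proposition1:
  fixes p m q n k d :: nat
    and \<iota> :: "'b::finite_field \<Rightarrow> 'a::finite_field"
    and \<alpha>s :: "'a list"
    and C :: "'a vec set"
  assumes "prime p" and "m > 1" and "q = p ^ m"
    and "CARD('a) = q" and "CARD('b) = p"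
    and "field_hom \<iota>"
    and "distinct \<alpha>s" and "set \<alpha>s = UNIV - {0}" and "hd \<alpha>s = 1"
    and "linear_code n k d C"
  shows "linear_code ((q - 1) * n) (m * k) ((q * (p - 1) div p) * d)
           (trace_code \<iota> p m (scaled_code \<alpha>s C)) \<and>
         weight_enumerator ((q - 1) * n) (trace_code \<iota> p m (scaled_code \<alpha>s C)) =
           (\<Sum>i\<le>n. monom (weight_count C i) (q * (p - 1) * i div p))"
proof -
  interpret field_hom \<iota> by fact
  interpret finite_field_trace \<iota> p m
    using assms by unfold_locales auto
  define T where "T = (\<lambda>c. map_vec tr (scaled_copies \<alpha>s c))"
  define N where "N = p ^ (m - 1) * (p - 1)"
  have p1: "p > 1"
    using prime_p by (rule prime_gt_1_nat)
  have D: "trace_code \<iota> p m (scaled_code \<alpha>s C) = T ` C"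
    by (simp add: trace_code_def scaled_code_def image_image T_def)
  have len: "length \<alpha>s = q - 1"
    using distinct_card[OF assms(7)] assms(4,8) by simp
  have q: "q = p * p ^ (m - 1)"
    using card_ext_Suc assms(4) by simp
  \<comment> \<open>The division is exact because p divides q. The case i = 1 gives the factor in
    the minimum weight, general i the exponents of the enumerator.\<close>
  have qN: "q * (p - 1) * i div p = N * i" for i
    using p1 by (simp add: q N_def mult.assoc)
  have sub: "VectorSpace.subspace class_ring C (module_vec TYPE('a) n)"
    and dimC: "vectorspace.dim class_ring ((module_vec TYPE('a) n)\<lparr>carrier := C\<rparr>) = k"
    and minC: "is_min_weight C d"
    using assms(10) by (auto simp: linear_code_def)
  have Cn: "C \<subseteq> carrier_vec n"
    using sub by (simp add: subspace_class_ring_iff)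
  have wT: "hamming_weight (T c) = N * hamming_weight c" for c
    unfolding T_def N_def by (rule hamming_weight_tr_scaled_copies[OF assms(7,8)])
  have dimT: "dim_vec (T c) = (q - 1) * dim_vec c" for c
    by (simp add: T_def len)
  have injT: "inj_on T C"
    unfolding T_def using inj_on_tr_scaled_copies[OF assms(7,8)] Cn by (rule inj_on_subset)
  have subT: "VectorSpace.subspace class_ring (T ` C) (module_vec TYPE('b) ((q - 1) * n))"
    using subspace_trace_code[OF sub, of \<alpha>s] by (simp add: D len)
  \<comment> \<open>The dimension follows by comparing exponents of p: by injectivity the trace code
    has as many words as \<open>C\<close>, namely \<open>q ^ k\<close>.\<close>
  have "p ^ vectorspace.dim class_ring ((module_vec TYPE('b) ((q - 1) * n))\<lparr>carrier := T ` C\<rparr>) =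
      card (T ` C)"
    using card_subspace_eq_card_power_dim(2)[OF subT] card_base by simp
  also have "\<dots> = p ^ (m * k)"
    using card_subspace_eq_card_power_dim(2)[OF sub] card_ext dimC
    by (simp add: card_image[OF injT] power_mult)
  finally have dimTC:
    "vectorspace.dim class_ring ((module_vec TYPE('b) ((q - 1) * n))\<lparr>carrier := T ` C\<rparr>) = m * k"
    using p1 by (simp add: power_inject_exp)
  have N0: "N > 0"
    using p1 by (simp add: N_def)
  \<comment> \<open>Nonzero words correspond to nonzero words, so a word of minimum weight in
    \<open>C\<close> is sent to one of minimum weight in the image.\<close>
  have nz: "T c \<noteq> 0\<^sub>v (dim_vec (T c)) \<longleftrightarrow> c \<noteq> 0\<^sub>v (dim_vec c)" for c
    using N0 wT[of c] by (simp flip: hamming_weight_eq_0_iff)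
  have "is_min_weight (T ` C) (N * d)"
    using minC unfolding is_min_weight_def by (auto simp: nz wT)
  then have code: "linear_code ((q - 1) * n) (m * k) (q * (p - 1) div p * d) (T ` C)"
    using subT dimTC qN[of 1] by (simp add: linear_code_def)
  have finC: "finite C"
    by (rule card_subspace_eq_card_power_dim(1)[OF sub])
  have dim_n: "dim_vec c = n" if "c \<in> C" for c
    using Cn that by auto
  have leC: "hamming_weight c \<le> n" if "c \<in> C" for c
    using hamming_weight_le_dim[of c] dim_n[OF that] by simp
  have leT: "hamming_weight x \<le> (q - 1) * n" if "x \<in> T ` C" for x
    using hamming_weight_le_dim[of x] dim_n dimT that by auto
  \<comment> \<open>Both enumerators are rewritten as sums over codewords, where injectivity of
    \<open>T\<close> allows reindexing.\<close>
  have "weight_enumerator ((q - 1) * n) (T ` C) =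
      (\<Sum>x\<in>T ` C. monom 1 (hamming_weight x))"
    unfolding weight_enumerator_def
    using finC leT by (intro sum_monom_weight_count[where f = "\<lambda>i. i"]) auto
  also have "\<dots> = (\<Sum>c\<in>C. monom 1 (N * hamming_weight c))"
    by (simp add: sum.reindex[OF injT] wT)
  also have "\<dots> = (\<Sum>i\<le>n. monom (weight_count C i) (N * i))"
    by (rule sum_monom_weight_count[OF finC leC, symmetric])
  finally show ?thesis
    using code unfolding D qN by blast
qed

end
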